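(* Let $k$ be a positive integer, $p$ a positive real number, and $f:\mathbb N\to\mathbb C$ a function. For real $x\ge 1$ and $t\in\mathbb R$ let $$S_k(x,t)=\sum_{1\le n\le x}f(n)e^{2\pi i n^kt},\qquad F_{k,p}(t)=\sum_{n=1}^\infty\frac{f(n)e^{2\pi i n^kt}}{n^p}.$$ Assume that for some positive constants $C$ and $\alpha$ with $\max(0,p-k)<\alpha<p$ we have $|S_k(x,t)|\le Cx^{\alpha}$ for all real $x\ge1$ and all $t\in\mathbb R$. Then: (i) The upper box-counting dimension of the image $F_{k,p}([0,1])=\{(\operatorname{Re}F_{k,p}(t),\operatorname{Im}F_{k,p}(t))\in\mathbb R^2:t\in[0,1]\}$ satisfies $$\overline{\dim_B}(F_{k,p}([0,1]))\le\frac{k}{p-\alpha}.$$ (ii) The upper box-counting dimension of the graph $G(F_{k,p})=\{(t,|F_{k,p}(t)|)\in\mathbb R^2:t\in[0,1]\}$ satisfies $$\overline{\dim_B}(G(F_{k,p}))\le 2-\frac{p-\alpha}{k}.$$ Moreover, the same bound holds for the upper box-counting dimensions of the graphs $G_R(F_{k,p})=\{(t,\operatorname{Re}F_{k,p}(t)):t\in[0,1]\}$ and $G_I(F_{k,p})=\{(t,\operatorname{Im}F_{k,p}(t)):t\in[0,1]\}$.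
   Context: $\mathbb N=\{1,2,3,\dots\}$. The infinite series defining $F_{k,p}(t)$ is understood as the limit of its partial sums $\sum_{n=1}^N$ as $N\to\infty$; under the hypothesis of the claim this limit exists for every $t\in\mathbb R$. For a bounded set $E\subset\mathbb R^d$ and $r>0$, let $N(E,r)$ be the minimal number of sets of diameter at most $r$ needed to cover $E$. The upper box-counting dimension of $E$ is $\overline{\dim_B}E=\limsup_{r\to0}\frac{\log N(E,r)}{\log(1/r)}$. *)

theory Defs
  imports "HOL-Analysis.Analysis"
begin

(* Coefficients are f 1, f 2, ...; the value f 0 is never used. *)

definition exp_sum :: "(nat \<Rightarrow> complex) \<Rightarrow> nat \<Rightarrow> real \<Rightarrow> real \<Rightarrow> complex" where
  "exp_sum f k x t =
     (\<Sum>n | 1 \<le> n \<and> real n \<le> x. f n * exp (2 * of_real pi * \<i> * of_nat (n ^ k) * of_real t))"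

(* The series need not converge absolutely, so it is the limit of its partial sums. *)
definition exp_series :: "(nat \<Rightarrow> complex) \<Rightarrow> nat \<Rightarrow> real \<Rightarrow> real \<Rightarrow> complex" where
  "exp_series f k p t =
     lim (\<lambda>N. \<Sum>n = 1..N.
       f n * exp (2 * of_real pi * \<i> * of_nat (n ^ k) * of_real t) / of_real (real n powr p))"

(* The library's diameter is unspecified on unbounded sets, hence the extra boundedness condition. *)
definition diam_cover :: "'a::metric_space set \<Rightarrow> real \<Rightarrow> 'a set set \<Rightarrow> bool" where
  "diam_cover E r \<U> \<longleftrightarrow> E \<subseteq> \<Union>\<U> \<and> (\<forall>U\<in>\<U>. bounded U \<and> diameter U \<le> r)"

(* Equal to infinity when E has no finite cover by sets of diameter at most r. *)
definition covering_number :: "'a::metric_space set \<Rightarrow> real \<Rightarrow> enat" where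
  "covering_number E r = (INF \<U> \<in> {\<U>. finite \<U> \<and> diam_cover E r \<U>}. enat (card \<U>))"

(* Intended for nonempty bounded E. An unbounded E gets dimension infinity; the empty set gets 0,
   because ln 0 = 0. *)
definition upper_box_dim :: "'a::metric_space set \<Rightarrow> ereal" where
  "upper_box_dim E =
     Limsup (at_right 0) (\<lambda>r::real.
       case covering_number E r of
         enat N \<Rightarrow> ereal (ln (real N) / ln (1 / r))
       | \<infinity> \<Rightarrow> \<infinity>)"

end

theory Submission
  imports Defs
begin

text \<open>The function F is Hoelder continuous with exponent \<^term>\<open>(p - \<alpha>) / real k\<close>: by partial
  summation the tail of the series beyond N is of order \<^term>\<open>real N powr (\<alpha> - p)\<close>, while the
  derivative of its N-th partial sum is of order \<^term>\<open>real N powr (real k - p + \<alpha>)\<close>, the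
  exponent being positive because \<^term>\<open>p - real k < \<alpha>\<close>. Both dimension bounds then come from
  covering the images of equal subintervals of the unit interval.\<close>

section \<open>Covering numbers and upper box dimension\<close>

text \<open>Covers are given as indexed families so that they can be counted by index; coinciding
  members only lower the count. The pairwise distance bound yields both boundedness and diameter,
  and \<open>0 \<le> r\<close> takes care of empty members, whose diameter is 0.\<close>

lemma covering_number_le:
  assumes "finite I" and "E \<subseteq> (\<Union>i\<in>I. U i)" and "0 \<le> r"
    and dist: "\<And>i u v. i \<in> I \<Longrightarrow> u \<in> U i \<Longrightarrow> v \<in> U i \<Longrightarrow> dist u v \<le> r"
  shows "covering_number E r \<le> enat (card I)"
proof -
  have "bounded (U i)" if "i \<in> I" for i
    unfolding bounded_two_points using dist[OF that] by blast
  moreover have "diameter (U i) \<le> r" if "i \<in> I" for i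
    unfolding diameter_def using dist[OF that] \<open>0 \<le> r\<close> by (auto intro!: cSUP_least)
  ultimately have "covering_number E r \<le> enat (card (U ` I))"
    unfolding covering_number_def diam_cover_def using assms by (intro INF_lower) auto
  also have "\<dots> \<le> enat (card I)"
    using card_image_le[OF assms(1)] by simp
  finally show ?thesis .
qed

text \<open>After taking logarithms, the factor \<open>A\<close> contributes only
  \<open>ln A / ln (1 / r)\<close>, which vanishes as r tends to 0. Later covers may therefore waste
  constant factors freely.\<close>

lemma upper_box_dim_le:
  assumes "d \<ge> 0" and "A \<ge> 1"
    and cover: "\<And>r. 0 < r \<Longrightarrow> r < 1 \<Longrightarrow> \<exists>n. covering_number E r \<le> enat n \<and> real n \<le> A * r powr (-d)"
  shows "upper_box_dim E \<le> ereal d"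
proof -
  let ?h = "\<lambda>r::real. ln A / ln (1 / r) + d"
  have ev: "eventually (\<lambda>r. (case covering_number E r of
         enat N \<Rightarrow> ereal (ln (real N) / ln (1 / r)) | \<infinity> \<Rightarrow> \<infinity>) \<le> ereal (?h r)) (at_right 0)"
    unfolding eventually_at_right_field
  proof (intro exI[of _ 1] conjI allI impI)
    fix r :: real assume r: "0 < r" "r < 1"
    have L: "ln (1 / r) > 0" using r by (simp add: ln_div)
    obtain n where n: "covering_number E r \<le> enat n" "real n \<le> A * r powr (-d)"
      using cover[OF r] by blast
    then obtain N where N: "covering_number E r = enat N" "N \<le> n"
      by (cases "covering_number E r") auto
    have one: "1 \<le> r powr (-d)"
      using r assms(1) by (simp add: powr_minus powr_le1 one_le_inverse_iff)
    have e: "ln (A * r powr (-d)) = ln A + d * ln (1 / r)"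
      using r assms(2) by (simp add: ln_mult ln_powr ln_div)
    have "ln (real N) \<le> ln A + d * ln (1 / r)"
    \<comment> \<open>For an empty cover \<open>ln 0 = 0\<close> by convention, so only
      nonnegativity of the right-hand side is left.\<close>
    proof (cases "N = 0")
      case True
      then show ?thesis using assms L by simp
    next
      case False
      then have "ln (real N) \<le> ln (A * r powr (-d))"
        using n N by (intro ln_mono) auto
      then show ?thesis using e by simp
    qed
    then have "ln (real N) / ln (1 / r) \<le> ?h r"
      using L by (simp add: field_simps)
    then show "(case covering_number E r of
         enat N \<Rightarrow> ereal (ln (real N) / ln (1 / r)) | \<infinity> \<Rightarrow> \<infinity>) \<le> ereal (?h r)"
      using N by simp
  qed simp
  have "filterlim (\<lambda>r::real. ln (1 / r)) at_top (at_right 0)"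
    by real_asymp
  then have "(?h \<longlongrightarrow> 0 + d) (at_right 0)"
    by (intro tendsto_add[OF real_tendsto_divide_at_top[OF tendsto_const] tendsto_const])
  then have "((\<lambda>r. ereal (?h r)) \<longlongrightarrow> ereal d) (at_right 0)"
    by simp
  then have "Limsup (at_right 0) (\<lambda>r. ereal (?h r)) = ereal d"
    by (intro lim_imp_Limsup) auto
  then show ?thesis
    unfolding upper_box_dim_def using Limsup_mono[OF ev] by simp
qed

section \<open>Box dimension of images and graphs of Hoelder functions\<close>

lemma ceiling_le_mult2:
  fixes x :: real
  assumes "x \<ge> 1"
  obtains m :: nat where "x \<le> real m" "real m \<le> 2 * x" "m \<ge> 1"
proof
  show "x \<le> real (nat \<lceil>x\<rceil>)" "real (nat \<lceil>x\<rceil>) \<le> 2 * x" "nat \<lceil>x\<rceil> \<ge> 1"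
    using assms by linarith+
qed

lemma unit_interval_partition:
  fixes t :: real and m :: nat
  assumes "t \<in> {0..1}" "m \<ge> 1"
  obtains i where "i \<le> m" "real i / real m \<le> t" "t \<le> (real i + 1) / real m"
proof
  \<comment> \<open>The value i = m occurs only at t = 1; this is why the covers below use m + 1
    cells.\<close>
  let ?i = "nat \<lfloor>t * real m\<rfloor>"
  have "0 \<le> t * real m" "t * real m \<le> real m"
    using assms by (auto simp: mult_left_le_one_le)
  then have "?i \<le> m" "real ?i \<le> t * real m" "t * real m \<le> real ?i + 1"
    by linarith+
  then show "?i \<le> m" "real ?i / real m \<le> t" "t \<le> (real ?i + 1) / real m"
    using assms by (auto simp: field_simps)
qed

text \<open>An interval of length 1/m has image of diameter at most M m^(-\<beta>), which drops
  below r once m is about (M/r)^(1/\<beta>); the number of such intervals gives the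
  exponent.\<close>

lemma upper_box_dim_holder_image:
  fixes g :: "real \<Rightarrow> 'a::metric_space"
  assumes "0 < \<beta>" "1 \<le> M"
    and holder: "\<And>s t. s \<in> {0..1} \<Longrightarrow> t \<in> {0..1} \<Longrightarrow> dist (g s) (g t) \<le> M * \<bar>s - t\<bar> powr \<beta>"
  shows "upper_box_dim (g ` {0..1}) \<le> ereal (1 / \<beta>)"
proof (rule upper_box_dim_le)
  show "0 \<le> 1 / \<beta>" using assms by simp
  have "1 \<le> M powr (1 / \<beta>)"
    using assms by (simp add: ge_one_powr_ge_zero)
  then show "1 \<le> 3 * M powr (1 / \<beta>)" by simp
  fix r :: real assume r: "0 < r" "r < 1"
  have Mr: "1 \<le> M / r" using r assms by simp
  let ?x = "(M / r) powr (1 / \<beta>)"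
  have x: "1 \<le> ?x"
    using Mr assms by (simp add: ge_one_powr_ge_zero)
  obtain m :: nat where m: "?x \<le> real m" "real m \<le> 2 * ?x" "m \<ge> 1"
    using ceiling_le_mult2[OF x] .
  \<comment> \<open>The cell with i = m reaches beyond 1, where no Hoelder bound is assumed, hence
    the intersection.\<close>
  let ?U = "\<lambda>i::nat. g ` ({0..1} \<inter> {real i / real m .. (real i + 1) / real m})"
  have "(?x) powr \<beta> \<le> real m powr \<beta>"
    using m x assms by (intro powr_mono2) auto
  then have "M / r \<le> real m powr \<beta>"
    using Mr r assms by (simp add: powr_powr)
  then have Mm: "M * (1 / real m) powr \<beta> \<le> r"
    using r m by (simp add: powr_divide field_simps)
  have close: "dist u v \<le> r" if uv: "u \<in> ?U i" "v \<in> ?U i" for u v i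
  proof -
    from uv obtain s t where st: "u = g s" "v = g t" "s \<in> {0..1}" "t \<in> {0..1}"
      "s \<in> {real i / real m .. (real i + 1) / real m}" "t \<in> {real i / real m .. (real i + 1) / real m}"
      by blast
    have "\<bar>s - t\<bar> \<le> 1 / real m"
      using st(5,6) unfolding add_divide_distrib atLeastAtMost_iff by linarith
    then have "M * \<bar>s - t\<bar> powr \<beta> \<le> M * (1 / real m) powr \<beta>"
      using assms by (intro mult_left_mono powr_mono2) auto
    then show ?thesis using holder[OF st(3,4)] st Mm by simp
  qed
  have "covering_number (g ` {0..1}) r \<le> enat (card {..m})"
  proof (rule covering_number_le[where U = ?U])
    show "g ` {0..1} \<subseteq> (\<Union>i\<in>{..m}. ?U i)"
    proof (clarify)
      fix t :: real assume t: "t \<in> {0..1}"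
      obtain i where "i \<le> m" "real i / real m \<le> t" "t \<le> (real i + 1) / real m"
        using unit_interval_partition[OF t m(3)] .
      then show "g t \<in> (\<Union>i\<in>{..m}. ?U i)"
        using t by (intro UN_I[of i]) auto
    qed
  qed (use r close in auto)
  moreover have "real (card {..m}) \<le> 3 * M powr (1 / \<beta>) * r powr (- (1 / \<beta>))"
  proof -
    \<comment> \<open>The m + 1 cells number at most 2 x + 1, and x is at least 1.\<close>
    have "real (card {..m}) \<le> 3 * ?x" using m x by simp
    also have "?x = M powr (1 / \<beta>) * r powr (- (1 / \<beta>))"
      using r assms by (simp add: powr_divide powr_minus divide_simps)
    finally show ?thesis by simp
  qed
  ultimately show "\<exists>n. covering_number (g ` {0..1}) r \<le> enat n \<and>
      real n \<le> 3 * M powr (1 / \<beta>) * r powr (- (1 / \<beta>))" by blast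
qed

text \<open>Over a column of width 1/m the oscillation of g is at most M m^(-\<beta>), so on the
  order of M m^(1 - \<beta>) squares of side 1/m suffice there. About m columns with m of order 1/r
  give r^(-(2 - \<beta>)).\<close>

lemma upper_box_dim_holder_graph:
  fixes g :: "real \<Rightarrow> real"
  assumes "0 < \<beta>" "\<beta> \<le> 1" "1 \<le> M"
    and holder: "\<And>s t. s \<in> {0..1} \<Longrightarrow> t \<in> {0..1} \<Longrightarrow> \<bar>g s - g t\<bar> \<le> M * \<bar>s - t\<bar> powr \<beta>"
  shows "upper_box_dim ((\<lambda>t. (t, g t)) ` {0..1}) \<le> ereal (2 - \<beta>)"
proof (rule upper_box_dim_le)
  show "0 \<le> 2 - \<beta>" using assms by simp
  have "1 \<le> (4::real) powr (2 - \<beta>)"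
    using assms by (simp add: ge_one_powr_ge_zero)
  then have "1 * 1 \<le> (10 * M) * 4 powr (2 - \<beta>)"
    using assms by (intro mult_mono) auto
  then show "1 \<le> 10 * M * 4 powr (2 - \<beta>)" by simp
  fix r :: real assume r: "0 < r" "r < 1"
  have "1 \<le> 2 / r" using r by simp
  \<comment> \<open>A square of side 1/m has diameter at most 2/m, so m \<ge> 2/r is what is
    required.\<close>
  then obtain m :: nat where m: "2 / r \<le> real m" "real m \<le> 2 * (2 / r)" "m \<ge> 1"
    using ceiling_le_mult2 by metis
  \<comment> \<open>This is the oscillation bound over a column in units of 1/m. Since \<beta> \<le>
    1 it is at least 1, so rounding it up to J costs at most a factor 2.\<close>
  let ?y = "M * real m powr (1 - \<beta>)"
  have "1 * 1 \<le> ?y"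
    using assms m by (intro mult_mono ge_one_powr_ge_zero) auto
  then have y: "1 \<le> ?y" by simp
  obtain J :: nat where J: "?y \<le> real J" "real J \<le> 2 * ?y"
    using ceiling_le_mult2[OF y] .
  define U where "U = (\<lambda>(i::nat, j::int). {real i / real m .. (real i + 1) / real m} \<times>
     {g (real i / real m) + of_int j / real m .. g (real i / real m) + (of_int j + 1) / real m})"
  let ?I = "{..m} \<times> {- int J .. int J}"
  have close: "dist u v \<le> r" if uv: "u \<in> U c" "v \<in> U c" for u v c
  proof -
    have *: "\<bar>fst u - fst v\<bar> \<le> 1 / real m" "\<bar>snd u - snd v\<bar> \<le> 1 / real m"
      using uv by (auto simp: U_def add_divide_distrib split: prod.splits)
    have "dist u v \<le> dist (fst u) (fst v) + dist (snd u) (snd v)"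
      by (simp add: dist_prod_def sqrt_sum_squares_le_sum)
    also have "\<dots> \<le> 2 / real m" using * by (simp add: dist_real_def)
    also have "\<dots> \<le> r" using m r by (simp add: field_simps)
    finally show ?thesis .
  qed
  have "covering_number ((\<lambda>t. (t, g t)) ` {0..1}) r \<le> enat (card ?I)"
  proof (rule covering_number_le[where U = U])
    show "(\<lambda>t. (t, g t)) ` {0..1} \<subseteq> (\<Union>i\<in>?I. U i)"
    proof clarify
      fix t :: real assume t: "t \<in> {0..1}"
      obtain i where i: "i \<le> m" "real i / real m \<le> t" "t \<le> (real i + 1) / real m"
        using unit_interval_partition[OF t m(3)] .
      let ?s = "real i / real m"
      have s: "?s \<in> {0..1}" using i m by auto
      have "\<bar>t - ?s\<bar> \<le> 1 / real m"
        using i by (simp add: add_divide_distrib)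
      then have "M * \<bar>t - ?s\<bar> powr \<beta> \<le> M * (1 / real m) powr \<beta>"
        using assms by (intro mult_left_mono powr_mono2) auto
      also have "\<dots> = ?y / real m"
        using m by (simp add: powr_diff powr_divide)
      also have "\<dots> \<le> real J / real m"
        using J by (intro divide_right_mono) auto
      finally have "\<bar>g t - g ?s\<bar> \<le> real J / real m"
        using holder[OF t s] by simp
      then have gJ: "\<bar>(g t - g ?s) * real m\<bar> \<le> real J"
        unfolding abs_mult using m by (simp add: pos_le_divide_eq)
      define j where "j = \<lfloor>(g t - g ?s) * real m\<rfloor>"
      have j: "- int J \<le> j" "j \<le> int J"
        using gJ unfolding j_def by linarith+
      have "of_int j \<le> (g t - g ?s) * real m" "(g t - g ?s) * real m \<le> of_int j + 1"
        unfolding j_def by linarith+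
      then have "of_int j / real m \<le> g t - g ?s" "g t - g ?s \<le> (of_int j + 1) / real m"
        using m by (simp_all add: pos_divide_le_eq pos_le_divide_eq)
      then have "(t, g t) \<in> U (i, j)"
        using i by (simp add: U_def)
      then show "(t, g t) \<in> (\<Union>i\<in>?I. U i)"
        using i j by (intro UN_I[of "(i, j)"]) auto
    qed
  qed (use r close in auto)
  moreover have "real (card ?I) \<le> 10 * M * 4 powr (2 - \<beta>) * r powr (- (2 - \<beta>))"
  proof -
    have "real (card ?I) = real (m + 1) * (2 * real J + 1)"
      by (simp add: card_cartesian_product algebra_simps)
    \<comment> \<open>Here m + 1 \<le> 2 m and 2 J + 1 \<le> 4 y + 1 \<le> 5 y, whence the constant
      10.\<close>
    also have "\<dots> \<le> (2 * real m) * (5 * ?y)"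
      using m J y by (intro mult_mono) auto
    also have "\<dots> = 10 * M * real m powr (2 - \<beta>)"
      using m powr_add[of "real m" 1 "1 - \<beta>"] by (simp add: algebra_simps)
    also have "\<dots> \<le> 10 * M * (4 / r) powr (2 - \<beta>)"
      using m r assms by (intro mult_left_mono powr_mono2) auto
    also have "\<dots> = 10 * M * 4 powr (2 - \<beta>) * r powr (- (2 - \<beta>))"
      using r powr_divide[of 4 r "2 - \<beta>"] unfolding powr_minus by (simp add: divide_simps)
    finally show ?thesis .
  qed
  ultimately show "\<exists>n. covering_number ((\<lambda>t. (t, g t)) ` {0..1}) r \<le> enat n \<and>
      real n \<le> 10 * M * 4 powr (2 - \<beta>) * r powr (- (2 - \<beta>))" by blast
qed

section \<open>Partial summation with power weights\<close>

text \<open>Cauchy's mean value theorem makes the quotient of the two increments equal to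
  \<^term>\<open>(q / \<gamma>) * z powr (- \<alpha>)\<close> at an intermediate point z.\<close>
lemma powr_increment_bound:
  fixes x y \<alpha> q \<gamma> :: real
  assumes "0 < x" "x < y" "0 \<le> \<alpha>" "\<gamma> = q + \<alpha>" "\<gamma> \<noteq> 0"
  shows "x powr \<alpha> * \<bar>y powr q - x powr q\<bar> \<le> \<bar>q\<bar> / \<bar>\<gamma>\<bar> * \<bar>y powr \<gamma> - x powr \<gamma>\<bar>"
proof -
  have D: "((\<lambda>z. z powr a) has_real_derivative a * z powr (a - 1)) (at z)" if "x \<le> z" for z a :: real
    using that assms by (auto intro!: derivative_eq_intros)
  obtain z where z: "x < z" "z < y"
    "(y powr q - x powr q) * (\<gamma> * z powr (\<gamma> - 1)) = (y powr \<gamma> - x powr \<gamma>) * (q * z powr (q - 1))"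
    using GMVT'[of x y "\<lambda>z. z powr q" "\<lambda>z. z powr \<gamma>" "\<lambda>z. \<gamma> * z powr (\<gamma> - 1)" "\<lambda>z. q * z powr (q - 1)"]
      assms D by (auto intro!: DERIV_isCont D)
  have pow: "z powr (\<gamma> - 1) = z powr \<alpha> * z powr (q - 1)"
    using assms by (simp flip: powr_add add: algebra_simps)
  have zq: "z powr (q - 1) \<noteq> 0" using z assms by simp
  have "z powr (q - 1) * ((y powr q - x powr q) * (\<gamma> * z powr \<alpha>)) = z powr (q - 1) * ((y powr \<gamma> - x powr \<gamma>) * q)"
    using z(3) unfolding pow by (simp only: mult_ac)
  then have "(y powr q - x powr q) * (\<gamma> * z powr \<alpha>) = (y powr \<gamma> - x powr \<gamma>) * q"
    using zq by simp
  then have "\<bar>(y powr q - x powr q) * (\<gamma> * z powr \<alpha>)\<bar> = \<bar>(y powr \<gamma> - x powr \<gamma>) * q\<bar>"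
    by simp
  then have "z powr \<alpha> * \<bar>y powr q - x powr q\<bar> = \<bar>q\<bar> / \<bar>\<gamma>\<bar> * \<bar>y powr \<gamma> - x powr \<gamma>\<bar>"
    using \<open>\<gamma> \<noteq> 0\<close> by (simp add: abs_mult divide_simps mult_ac)
  moreover have "x powr \<alpha> \<le> z powr \<alpha>"
    using z assms by (intro powr_mono2) auto
  ultimately show ?thesis
    by (metis abs_ge_zero mult_right_mono)
qed

text \<open>Abel summation, arranged so that every inner sum starts at 1, the form in which the
  hypothesis bounds it.\<close>

lemma sum_by_parts:
  fixes a :: "nat \<Rightarrow> 'a::real_normed_algebra_1" and w :: "nat \<Rightarrow> real"
  assumes "M < N"
  shows "(\<Sum>n=Suc M..N. w n *\<^sub>R a n) = w N *\<^sub>R (\<Sum>n=1..N. a n) - w (Suc M) *\<^sub>R (\<Sum>n=1..M. a n)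
     - (\<Sum>n=Suc M..<N. (w (Suc n) - w n) *\<^sub>R (\<Sum>i=1..n. a i))"
  using Suc_leI[OF assms]
proof (induction N rule: dec_induct)
  case base
  show ?case by (simp add: algebra_simps)
next
  case (step N)
  then show ?case by (simp add: algebra_simps)
qed

text \<open>Powers are monotone in n for either sign of the exponent, so all increments have one
  sign and telescope.\<close>

lemma sum_abs_increments_powr:
  fixes \<gamma> :: real
  assumes "1 \<le> m" "m \<le> N"
  shows "(\<Sum>n=m..<N. \<bar>real (Suc n) powr \<gamma> - real n powr \<gamma>\<bar>) = \<bar>real N powr \<gamma> - real m powr \<gamma>\<bar>"
proof (cases "\<gamma> \<ge> 0")
  case True
  have "(\<Sum>n=m..<N. \<bar>real (Suc n) powr \<gamma> - real n powr \<gamma>\<bar>) = (\<Sum>n=m..<N. real (Suc n) powr \<gamma> - real n powr \<gamma>)"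
    using True by (intro sum.cong refl abs_of_nonneg) (auto intro!: powr_mono2)
  also have "\<dots> = real N powr \<gamma> - real m powr \<gamma>"
    using assms by (intro sum_Suc_diff')
  also have "\<dots> = \<bar>\<dots>\<bar>"
    using True assms by (subst abs_of_nonneg) (auto intro!: powr_mono2)
  finally show ?thesis .
next
  case False
  have "(\<Sum>n=m..<N. \<bar>real (Suc n) powr \<gamma> - real n powr \<gamma>\<bar>) = (\<Sum>n=m..<N. - (real (Suc n) powr \<gamma> - real n powr \<gamma>))"
    using False assms by (intro sum.cong refl abs_of_nonpos) (auto intro!: powr_mono2')
  also have "\<dots> = - (real N powr \<gamma> - real m powr \<gamma>)"
    unfolding sum_negf using assms by (subst sum_Suc_diff') auto
  also have "\<dots> = \<bar>real N powr \<gamma> - real m powr \<gamma>\<bar>"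
    using False assms by (subst abs_of_nonpos) (auto intro!: powr_mono2')
  finally show ?thesis .
qed

text \<open>The three pieces of the summation by parts are bounded separately. In the last one
  \<open>powr_increment_bound\<close> trades n^\<alpha> times an increment of n^q for an increment
  of n^\<gamma>, and these telescope. The head (q = k - p) and the tail (q = -p) are both
  instances.\<close>

lemma norm_weighted_sum_le:
  fixes a :: "nat \<Rightarrow> 'a::real_normed_algebra_1" and C \<alpha> q \<gamma> :: real
  assumes A: "\<And>n. norm (\<Sum>i=1..n. a i) \<le> C * real n powr \<alpha>"
    and "0 \<le> C" "0 < \<alpha>" "\<gamma> = q + \<alpha>" "\<gamma> \<noteq> 0" "M < N"
  shows "norm (\<Sum>n=Suc M..N. real n powr q *\<^sub>R a n) \<le>
    C * (real N powr \<gamma> + real (Suc M) powr q * real M powr \<alpha> + \<bar>q\<bar> / \<bar>\<gamma>\<bar> * \<bar>real N powr \<gamma> - real (Suc M) powr \<gamma>\<bar>)"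
proof -
  let ?A = "\<lambda>n. \<Sum>i=1..n. a i"
  have 1: "norm (real N powr q *\<^sub>R ?A N) \<le> C * real N powr \<gamma>"
  proof -
    have "norm (real N powr q *\<^sub>R ?A N) \<le> real N powr q * (C * real N powr \<alpha>)"
      by (simp only: norm_scaleR abs_of_nonneg powr_ge_zero) (intro mult_left_mono A powr_ge_zero)
    then show ?thesis using assms by (simp add: powr_add mult_ac)
  qed
  have 2: "norm (real (Suc M) powr q *\<^sub>R ?A M) \<le> C * (real (Suc M) powr q * real M powr \<alpha>)"
  proof -
    have "norm (real (Suc M) powr q *\<^sub>R ?A M) \<le> real (Suc M) powr q * (C * real M powr \<alpha>)"
      by (simp only: norm_scaleR abs_of_nonneg powr_ge_zero) (intro mult_left_mono A powr_ge_zero)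
    then show ?thesis by (simp add: mult_ac)
  qed
  have 3: "norm (\<Sum>n=Suc M..<N. (real (Suc n) powr q - real n powr q) *\<^sub>R ?A n) \<le>
      C * (\<bar>q\<bar> / \<bar>\<gamma>\<bar> * \<bar>real N powr \<gamma> - real (Suc M) powr \<gamma>\<bar>)"
  proof -
    have "norm (\<Sum>n=Suc M..<N. (real (Suc n) powr q - real n powr q) *\<^sub>R ?A n) \<le>
       (\<Sum>n=Suc M..<N. C * (\<bar>q\<bar> / \<bar>\<gamma>\<bar> * \<bar>real (Suc n) powr \<gamma> - real n powr \<gamma>\<bar>))"
    proof (rule sum_norm_le)
      fix n assume "n \<in> {Suc M..<N}"
      then have n: "0 < real n" by simp
      have "norm ((real (Suc n) powr q - real n powr q) *\<^sub>R ?A n) \<le>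
         \<bar>real (Suc n) powr q - real n powr q\<bar> * (C * real n powr \<alpha>)"
        unfolding norm_scaleR by (intro mult_left_mono A) simp
      also have "\<dots> = C * (real n powr \<alpha> * \<bar>real (Suc n) powr q - real n powr q\<bar>)"
        by (simp only: mult_ac)
      also have "\<dots> \<le> C * (\<bar>q\<bar> / \<bar>\<gamma>\<bar> * \<bar>real (Suc n) powr \<gamma> - real n powr \<gamma>\<bar>)"
        using assms n by (intro mult_left_mono powr_increment_bound) auto
      finally show "norm ((real (Suc n) powr q - real n powr q) *\<^sub>R ?A n) \<le> \<dots>" .
    qed
    also have "\<dots> = C * (\<bar>q\<bar> / \<bar>\<gamma>\<bar> * \<bar>real N powr \<gamma> - real (Suc M) powr \<gamma>\<bar>)"
      using assms by (simp only: sum_distrib_left[symmetric]) (subst sum_abs_increments_powr; simp)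
    finally show ?thesis .
  qed
  show ?thesis
    unfolding sum_by_parts[OF \<open>M < N\<close>] distrib_left
    using 1 2 3 norm_triangle_ineq4 by (smt (verit))
qed

lemma norm_weighted_sum_le_growing:
  fixes a :: "nat \<Rightarrow> 'a::real_normed_algebra_1" and C \<alpha> q :: real
  assumes A: "\<And>n. norm (\<Sum>i=1..n. a i) \<le> C * real n powr \<alpha>"
    and "0 \<le> C" "0 < \<alpha>" "0 < q + \<alpha>" "1 \<le> N"
  shows "norm (\<Sum>n=1..N. real n powr q *\<^sub>R a n) \<le> C * (1 + \<bar>q\<bar> / (q + \<alpha>)) * real N powr (q + \<alpha>)"
proof -
  let ?g = "q + \<alpha>"
  have "norm (\<Sum>n=1..N. real n powr q *\<^sub>R a n) \<le>
    C * (real N powr ?g + \<bar>q\<bar> / ?g * \<bar>real N powr ?g - 1\<bar>)"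
    \<comment> \<open>With M = 0 the lower boundary term vanishes because
      \<open>0 powr \<alpha> = 0\<close>.\<close>
    using norm_weighted_sum_le[OF A, of ?g q 0 N] assms by simp
  also have "\<dots> \<le> C * (real N powr ?g + \<bar>q\<bar> / ?g * real N powr ?g)"
  proof -
    have "1 \<le> real N powr ?g" using assms by (intro ge_one_powr_ge_zero) auto
    then show ?thesis using assms by (intro mult_left_mono add_left_mono) auto
  qed
  finally show ?thesis by (simp add: algebra_simps)
qed

text \<open>As \<alpha> - p is negative, every power is dominated by the one at M. The 2 counts the
  boundary terms and p / (p - \<alpha>) comes from the telescoped increments.\<close>

lemma norm_weighted_sum_le_decaying:
  fixes a :: "nat \<Rightarrow> 'a::real_normed_algebra_1" and C \<alpha> p :: real
  assumes A: "\<And>n. norm (\<Sum>i=1..n. a i) \<le> C * real n powr \<alpha>"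
    and "0 \<le> C" "0 < \<alpha>" "\<alpha> < p" "1 \<le> M" "M < N"
  shows "norm (\<Sum>n=Suc M..N. real n powr (-p) *\<^sub>R a n) \<le> C * (2 + p / (p - \<alpha>)) * real M powr (\<alpha> - p)"
proof -
  let ?g = "\<alpha> - p"
  have "norm (\<Sum>n=Suc M..N. real n powr (-p) *\<^sub>R a n) \<le>
    C * (real N powr ?g + real (Suc M) powr (-p) * real M powr \<alpha> + \<bar>-p\<bar> / \<bar>?g\<bar> * \<bar>real N powr ?g - real (Suc M) powr ?g\<bar>)"
    using assms by (intro norm_weighted_sum_le[OF A]) auto
  also have "\<dots> \<le> C * (real M powr ?g + real M powr ?g + \<bar>-p\<bar> / \<bar>?g\<bar> * real M powr ?g)"
  proof (intro mult_left_mono add_mono)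
    show "real N powr ?g \<le> real M powr ?g"
      using assms by (intro powr_mono2') auto
    have "real (Suc M) powr (-p) * real M powr \<alpha> \<le> real M powr (-p) * real M powr \<alpha>"
      using assms by (intro mult_right_mono powr_mono2') auto
    then show "real (Suc M) powr (-p) * real M powr \<alpha> \<le> real M powr ?g"
      by (simp flip: powr_add)
    have "real N powr ?g \<le> real (Suc M) powr ?g" "real (Suc M) powr ?g \<le> real M powr ?g"
      using assms by (auto intro!: powr_mono2')
    then show "\<bar>real N powr ?g - real (Suc M) powr ?g\<bar> \<le> real M powr ?g"
      using powr_ge_zero[of "real N" ?g] by linarith
  qed (use assms in auto)
  also have "\<dots> = C * (2 + p / (p - \<alpha>)) * real M powr (\<alpha> - p)"
    using assms by (simp add: algebra_simps)
  finally show ?thesis .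
qed

section \<open>Tail and head of the exponential series, and Hoelder continuity\<close>

text \<open>Separating the numerator from the weight makes both the series (weights n^(-p)) and its
  derivative (weights n^(k - p)) weighted sums of the same terms.\<close>

definition exp_term :: "(nat \<Rightarrow> complex) \<Rightarrow> nat \<Rightarrow> real \<Rightarrow> nat \<Rightarrow> complex" where
  "exp_term f k t n = f n * exp (2 * of_real pi * \<i> * of_nat (n ^ k) * of_real t)"

lemma exp_sum_of_nat: "exp_sum f k (real N) t = (\<Sum>n=1..N. exp_term f k t n)"
  unfolding exp_sum_def exp_term_def by (rule sum.cong) auto

lemma exp_series_eq_lim:
  "exp_series f k p t = lim (\<lambda>N. \<Sum>n=1..N. real n powr (-p) *\<^sub>R exp_term f k t n)"
  unfolding exp_series_def exp_term_def
  by (simp add: powr_minus scaleR_conv_of_real divide_inverse mult_ac)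

lemma norm_exp_term_sum_le:
  assumes "\<And>x t :: real. x \<ge> 1 \<Longrightarrow> norm (exp_sum f k x t) \<le> C * x powr \<alpha>"
  shows "norm (\<Sum>n=1..N. exp_term f k t n) \<le> C * real N powr \<alpha>"
  \<comment> \<open>The hypothesis starts at x = 1; for N = 0 the empty sum meets
    \<open>0 powr \<alpha> = 0\<close>.\<close>
  using assms[of "real N" t] by (cases "N = 0") (auto simp: exp_sum_of_nat)

text \<open>The bound makes \<open>s\<close> a Cauchy sequence, so \<open>lim s\<close> is a genuine
  limit, and letting N tend to infinity preserves the estimate.\<close>

lemma norm_lim_diff_le:
  fixes s :: "nat \<Rightarrow> 'a::banach"
  assumes bound: "\<And>M N. 1 \<le> M \<Longrightarrow> M < N \<Longrightarrow> norm (s N - s M) \<le> b M"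
    and "b \<longlonglongrightarrow> 0" and "1 \<le> M"
  shows "norm (lim s - s M) \<le> b M"
proof -
  have "Cauchy s"
  proof (rule CauchyI')
    fix e :: real assume "0 < e"
    then have "eventually (\<lambda>m. b m < e) sequentially"
      using assms(2) by (simp add: order_tendsto_iff)
    then obtain m0 where "\<And>m. m \<ge> m0 \<Longrightarrow> b m < e"
      unfolding eventually_sequentially by blast
    then show "\<exists>M. \<forall>m\<ge>M. \<forall>n>m. dist (s m) (s n) < e"
      by (intro exI[of _ "max 1 m0"]) (smt (verit) bound max.bounded_iff norm_minus_commute dist_norm)
  qed
  then have "s \<longlonglongrightarrow> lim s"
    by (simp add: Cauchy_convergent_iff convergent_LIMSEQ_iff)
  then have "(\<lambda>N. norm (s N - s M)) \<longlonglongrightarrow> norm (lim s - s M)"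
    by (intro tendsto_intros)
  then show ?thesis
    by (rule LIMSEQ_le_const2) (use bound \<open>1 \<le> M\<close> in \<open>auto intro!: exI[of _ "Suc M"]\<close>)
qed

lemma norm_exp_series_tail_le:
  fixes C \<alpha> p :: real
  assumes A: "\<And>n. norm (\<Sum>i=1..n. exp_term f k t i) \<le> C * real n powr \<alpha>"
    and "0 \<le> C" "0 < \<alpha>" "\<alpha> < p" "1 \<le> M"
  shows "norm (exp_series f k p t - (\<Sum>n=1..M. real n powr (-p) *\<^sub>R exp_term f k t n))
    \<le> C * (2 + p / (p - \<alpha>)) * real M powr (\<alpha> - p)"
  unfolding exp_series_eq_lim
proof (rule norm_lim_diff_le)
  let ?s = "\<lambda>N. \<Sum>n=1..N. real n powr (-p) *\<^sub>R exp_term f k t n"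
  fix M N :: nat assume MN: "1 \<le> M" "M < N"
  have "?s N - ?s M = (\<Sum>n=Suc M..N. real n powr (-p) *\<^sub>R exp_term f k t n)"
    using MN sum.ub_add_nat[of 1 M "\<lambda>n. real n powr (-p) *\<^sub>R exp_term f k t n" "N - M"] by simp
  then show "norm (?s N - ?s M) \<le> C * (2 + p / (p - \<alpha>)) * real M powr (\<alpha> - p)"
    using norm_weighted_sum_le_decaying[OF A] assms MN by simp
next
  have "(\<lambda>M. real M powr (\<alpha> - p)) \<longlonglongrightarrow> 0"
    using assms by (intro tendsto_neg_powr filterlim_real_sequentially) auto
  then show "(\<lambda>M. C * (2 + p / (p - \<alpha>)) * real M powr (\<alpha> - p)) \<longlonglongrightarrow> 0"
    by (rule tendsto_mult_right_zero)
qed (use assms in auto)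

text \<open>Differentiation brings down 2 pi i n^k, turning the weights n^(-p) into n^(k - p); the
  growing case of partial summation bounds this derivative, and the mean value inequality
  finishes.\<close>

lemma norm_exp_series_head_diff_le:
  fixes C \<alpha> p :: real
  assumes A: "\<And>n t. norm (\<Sum>i=1..n. exp_term f k t i) \<le> C * real n powr \<alpha>"
    and "0 \<le> C" "0 < \<alpha>" "p - real k < \<alpha>" "1 \<le> N"
  shows "norm ((\<Sum>n=1..N. real n powr (-p) *\<^sub>R exp_term f k s n) - (\<Sum>n=1..N. real n powr (-p) *\<^sub>R exp_term f k t n))
    \<le> 2 * pi * (C * (1 + \<bar>real k - p\<bar> / (real k - p + \<alpha>)) * real N powr (real k - p + \<alpha>)) * \<bar>s - t\<bar>"
proof -
  let ?c = "\<lambda>n. 2 * of_real pi * \<i> * of_nat (n ^ k)"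
  let ?h = "\<lambda>z. \<Sum>n=1..N. of_real (real n powr (-p)) * (f n * exp (?c n * z))"
  let ?h' = "\<lambda>z. \<Sum>n=1..N. of_real (real n powr (-p)) * (f n * (exp (?c n * z) * ?c n))"
  let ?B = "2 * pi * (C * (1 + \<bar>real k - p\<bar> / (real k - p + \<alpha>)) * real N powr (real k - p + \<alpha>))"
  have "norm (?h (of_real s) - ?h (of_real t)) \<le> ?B * norm (of_real s - of_real t :: complex)"
  \<comment> \<open>The inequality is stated for complex derivatives. Restricting to the convex set
    of reals keeps the derivative within reach of the hypothesis, which concerns real t
    only.\<close>
  proof (rule field_differentiable_bound[where S = "\<real>" and f' = ?h'])
    show "convex (\<real> :: complex set)" by (rule convex_Reals)
    fix z :: complex assume "z \<in> \<real>"
    then obtain u where u: "z = of_real u" by (auto elim: Reals_cases)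
    show "(?h has_field_derivative ?h' z) (at z within \<real>)"
      by (auto intro!: derivative_eq_intros sum.cong)
    have "of_real (real n powr (-p)) * (f n * (exp (?c n * z) * ?c n))
        = (2 * of_real pi * \<i>) * (real n powr (real k - p) *\<^sub>R exp_term f k u n)" if "n \<in> {1..N}" for n
    proof -
      have "real n powr (real k - p) = real (n ^ k) * real n powr (-p)"
        using that by (simp add: powr_diff powr_minus powr_realpow divide_inverse)
      then show ?thesis
        by (simp add: exp_term_def u scaleR_conv_of_real)
    qed
    then have "?h' z = (2 * of_real pi * \<i>) * (\<Sum>n=1..N. real n powr (real k - p) *\<^sub>R exp_term f k u n)"
      unfolding sum_distrib_left by (rule sum.cong[OF refl])
    then have "norm (?h' z) = 2 * pi * norm (\<Sum>n=1..N. real n powr (real k - p) *\<^sub>R exp_term f k u n)"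
      by (simp add: norm_mult)
    also have "\<dots> \<le> ?B"
      using assms by (intro mult_left_mono norm_weighted_sum_le_growing[OF A]) auto
    finally show "norm (?h' z) \<le> ?B" .
  qed auto
  then show ?thesis
    by (simp add: exp_term_def scaleR_conv_of_real flip: of_real_diff)
qed

text \<open>The series is split at \<^term>\<open>N\<close> of order \<^term>\<open>\<bar>s - t\<bar> powr (- 1 / real k)\<close>, which balances
  the head estimate against the tail estimate.\<close>
lemma exp_series_holder:
  fixes C \<alpha> p :: real
  assumes "k > 0" "C > 0" "0 < \<alpha>" "p - real k < \<alpha>" "\<alpha> < p"
    and A: "\<And>n t. norm (\<Sum>i=1..n. exp_term f k t i) \<le> C * real n powr \<alpha>"
  obtains M where "1 \<le> M" and "\<And>s t. s \<in> {0..1} \<Longrightarrow> t \<in> {0..1} \<Longrightarrow>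
      norm (exp_series f k p s - exp_series f k p t) \<le> M * \<bar>s - t\<bar> powr ((p - \<alpha>) / real k)"
proof -
  let ?g = "real k - p + \<alpha>"
  let ?b = "(p - \<alpha>) / real k"
  let ?K = "C * (2 + p / (p - \<alpha>))"
  let ?L = "2 * pi * (C * (1 + \<bar>real k - p\<bar> / ?g))"
  have K: "0 \<le> ?K" and L: "0 \<le> ?L"
    using assms by auto
  \<comment> \<open>Two tails contribute 2 K, the head contributes the L term, and the 1 ensures M
    \<ge> 1.\<close>
  let ?M = "1 + (2 * ?K + ?L * 2 powr ?g)"
  show thesis
  proof (rule that[of ?M])
    show "1 \<le> ?M" using K L by simp
    fix s t :: real assume st: "s \<in> {0..1}" "t \<in> {0..1}"
    show "norm (exp_series f k p s - exp_series f k p t) \<le> ?M * \<bar>s - t\<bar> powr ?b"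
    proof (cases "s = t")
      case False
      define h where "h = \<bar>s - t\<bar>"
      have h: "0 < h" "h \<le> 1" using st False by (auto simp: h_def)
      \<comment> \<open>Since h \<le> 1, the ideal cutoff is at least 1, so rounding it up to N at
        most doubles it.\<close>
      have "1 \<le> h powr (- 1 / real k)"
        using h assms by (simp add: powr_minus powr_le1 one_le_inverse_iff)
      then obtain N :: nat where N: "h powr (- 1 / real k) \<le> real N" "real N \<le> 2 * h powr (- 1 / real k)" "1 \<le> N"
        using ceiling_le_mult2 by blast
      let ?S = "\<lambda>t. \<Sum>n=1..N. real n powr (-p) *\<^sub>R exp_term f k t n"
      have tail: "norm (exp_series f k p u - ?S u) \<le> ?K * h powr ?b" for u
      proof -
        have "real N powr (\<alpha> - p) \<le> (h powr (- 1 / real k)) powr (\<alpha> - p)"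
          using N h assms by (intro powr_mono2') auto
        also have "\<dots> = h powr ?b"
          unfolding powr_powr by (simp add: algebra_simps diff_divide_distrib)
        finally have "?K * real N powr (\<alpha> - p) \<le> ?K * h powr ?b"
          using K by (intro mult_left_mono)
        then show ?thesis
          using norm_exp_series_tail_le[OF A, where p = p and t = u and M = N] assms N by linarith
      qed
      have head: "norm (?S s - ?S t) \<le> ?L * 2 powr ?g * h powr ?b"
      proof -
        have "real N powr ?g \<le> (2 * h powr (- 1 / real k)) powr ?g"
          using N assms by (intro powr_mono2) auto
        also have "\<dots> = 2 powr ?g * h powr (?b - 1)"
        proof -
          \<comment> \<open>The missing factor h is supplied by the mean value inequality, which
            restores the exponent b.\<close>
          have "- 1 / real k * ?g = ?b - 1"
            using assms by (simp add: field_simps)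
          then show ?thesis
            by (simp only: powr_mult powr_powr)
        qed
        finally have "real N powr ?g * h \<le> 2 powr ?g * h powr (?b - 1) * h"
          using h by (intro mult_right_mono) auto
        also have "\<dots> = 2 powr ?g * h powr ?b"
          using h by (simp add: powr_diff)
        finally have "?L * (real N powr ?g * h) \<le> ?L * (2 powr ?g * h powr ?b)"
          using L by (intro mult_left_mono)
        moreover have "norm (?S s - ?S t) \<le> ?L * (real N powr ?g * h)"
          using norm_exp_series_head_diff_le[OF A, where p = p and s = s and t = t and N = N] assms N
          by (simp add: h_def mult.assoc)
        ultimately show ?thesis by (simp add: mult_ac)
      qed
      have "norm (exp_series f k p s - exp_series f k p t) \<le>
          norm (exp_series f k p s - ?S s) + norm (?S s - ?S t) + norm (exp_series f k p t - ?S t)"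
        by norm
      also have "\<dots> \<le> ?K * h powr ?b + ?L * 2 powr ?g * h powr ?b + ?K * h powr ?b"
        by (intro add_mono tail head)
      also have "\<dots> = (2 * ?K + ?L * 2 powr ?g) * h powr ?b"
        by (simp only: distrib_right mult_2)
      also have "\<dots> \<le> ?M * h powr ?b"
        by (intro mult_right_mono) auto
      finally show ?thesis by (simp add: h_def)
    qed simp
  qed
qed

theorem corollary1p4:
  fixes f :: "nat \<Rightarrow> complex" and k :: nat and p C \<alpha> :: real
  assumes "k > 0" and "p > 0"
    and "C > 0" and "\<alpha> > 0"
    and "max 0 (p - real k) < \<alpha>" and "\<alpha> < p"
    and "\<And>x t :: real. x \<ge> 1 \<Longrightarrow> norm (exp_sum f k x t) \<le> C * x powr \<alpha>"
  shows "upper_box_dim ((\<lambda>t. (Re (exp_series f k p t), Im (exp_series f k p t))) ` {0..1})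
           \<le> ereal (real k / (p - \<alpha>)) \<and>
         upper_box_dim ((\<lambda>t. (t, norm (exp_series f k p t))) ` {0..1})
           \<le> ereal (2 - (p - \<alpha>) / real k) \<and>
         upper_box_dim ((\<lambda>t. (t, Re (exp_series f k p t))) ` {0..1})
           \<le> ereal (2 - (p - \<alpha>) / real k) \<and>
         upper_box_dim ((\<lambda>t. (t, Im (exp_series f k p t))) ` {0..1})
           \<le> ereal (2 - (p - \<alpha>) / real k)"
proof -
  let ?F = "exp_series f k p" and ?b = "(p - \<alpha>) / real k"
  \<comment> \<open>The upper bound is p - k < \<alpha> rearranged; the graph estimate relies on
    it.\<close>
  have b: "0 < ?b" "?b \<le> 1" using assms by auto
  obtain M where M: "1 \<le> M" and holder: "\<And>s t. s \<in> {0..1} \<Longrightarrow> t \<in> {0..1} \<Longrightarrow>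
      norm (?F s - ?F t) \<le> M * \<bar>s - t\<bar> powr ?b"
  proof (rule exp_series_holder[of k C \<alpha> p f])
    show "norm (\<Sum>i=1..n. exp_term f k t i) \<le> C * real n powr \<alpha>" for n t
      by (rule norm_exp_term_sum_le) (rule assms)
  qed (use assms in auto)
  have "upper_box_dim ((\<lambda>t. (Re (?F t), Im (?F t))) ` {0..1}) \<le> ereal (1 / ?b)"
  proof (rule upper_box_dim_holder_image[OF b(1) M])
    fix s t :: real assume "s \<in> {0..1}" "t \<in> {0..1}"
    then show "dist (Re (?F s), Im (?F s)) (Re (?F t), Im (?F t)) \<le> M * \<bar>s - t\<bar> powr ?b"
      using holder[of s t] by (simp add: dist_prod_def dist_real_def cmod_def)
  qed
  \<comment> \<open>Any 1-Lipschitz real function of F inherits its Hoelder bound; modulus, real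
    part and imaginary part are three such functions.\<close>
  moreover have graph: "upper_box_dim ((\<lambda>t. (t, g (?F t))) ` {0..1}) \<le> ereal (2 - ?b)"
    if "\<And>z w. \<bar>g z - g w\<bar> \<le> norm (z - w)" for g :: "complex \<Rightarrow> real"
    using that order_trans holder by (intro upper_box_dim_holder_graph[OF b M]) blast
  moreover have "upper_box_dim ((\<lambda>t. (t, norm (?F t))) ` {0..1}) \<le> ereal (2 - ?b)"
    by (rule graph) (rule norm_triangle_ineq3)
  moreover have "upper_box_dim ((\<lambda>t. (t, Re (?F t))) ` {0..1}) \<le> ereal (2 - ?b)"
    by (rule graph) (metis abs_Re_le_cmod minus_complex.sel(1))
  moreover have "upper_box_dim ((\<lambda>t. (t, Im (?F t))) ` {0..1}) \<le> ereal (2 - ?b)"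
    by (rule graph) (metis abs_Im_le_cmod minus_complex.sel(2))
  ultimately show ?thesis by simp
qed

end
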